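(* A topological space $X$ is a UV-space if and only if $X$ is homeomorphic to the upper Vietoris space of a Stone locale.
   Context: The base theory is ZF (no choice principles). For a topological space $X$, its specialization order is: $x\leqslant y$ iff every open set containing $x$ contains $y$. For $U\subseteq X$, put $\mathsf{cl}_\leqslant(U)=\{x\in X\mid \exists y\in X: x\leqslant y,\ y\in U\}$ and $\mathsf{int}_\leqslant(U)=\{x\in X\mid \forall y\in X:\ x\leqslant y\Rightarrow y\in U\}$. $\mathcal{RO}(X)$ is the collection of sets $U\subseteq X$ with $U=\mathsf{int}_\leqslant(\mathsf{cl}_\leqslant(U))$ (the regular open sets of the topology of $\leqslant$-upsets). $\mathsf{CO}\mathcal{RO}(X)$ is the collection of subsets of $X$ that are compact and open in $X$ and belong to $\mathcal{RO}(X)$; for $x\in X$, $\mathsf{CO}\mathcal{RO}(x)=\{U\in\mathsf{CO}\mathcal{RO}(X)\mid x\in U\}$. A UV-space is a $T_0$ space $X$ such that (i) $\mathsf{CO}\mathcal{RO}(X)$ is closed under binary intersection and under $U\mapsto \mathsf{int}_\leqslant(X\setminus U)$ and is a basis for $X$; and (ii) every proper filter in $\mathsf{CO}\mathcal{RO}(X)$ (ordered by inclusion) is $\mathsf{CO}\mathcal{RO}(x)$ for some $x\in X$. A locale is a complete lattice $L$ satisfying $a\wedge\bigvee Y=\bigvee\{a\wedge y\mid y\in Y\}$ for all $a\in L$, $Y\subseteq L$. It is compact if $\bigvee Y=1$ implies $\bigvee Y_0=1$ for some finite $Y_0\subseteq Y$. It is zero-dimensional if each element is a join of complemented elements, where $a$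 is complemented if there is $b$ with $a\wedge b=0$ and $a\vee b=1$. A Stone locale is a compact zero-dimensional locale. The upper Vietoris space of a Stone locale $L$ is the space whose set of points is $L^-=\{x\in L\mid x\neq 1\}$ and whose topology is generated by the sets $\blacksquare x=\{y\in L^-\mid x\vee y=1\}$, $x\in L$. *)

theory Defs
  imports "HOL-Analysis.Analysis" "HOL-Algebra.Complete_Lattice"
begin

section \<open>UV-spaces\<close>

definition spec_le :: "'a topology \<Rightarrow> 'a \<Rightarrow> 'a \<Rightarrow> bool" where
  "spec_le X x y \<longleftrightarrow> x \<in> topspace X \<and> y \<in> topspace X \<and>
     (\<forall>U. openin X U \<longrightarrow> x \<in> U \<longrightarrow> y \<in> U)"

definition cl_le :: "'a topology \<Rightarrow> 'a set \<Rightarrow> 'a set" where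
  "cl_le X U = {x \<in> topspace X. \<exists>y \<in> topspace X. spec_le X x y \<and> y \<in> U}"

definition int_le :: "'a topology \<Rightarrow> 'a set \<Rightarrow> 'a set" where
  "int_le X U = {x \<in> topspace X. \<forall>y \<in> topspace X. spec_le X x y \<longrightarrow> y \<in> U}"

definition RO :: "'a topology \<Rightarrow> 'a set set" where
  "RO X = {U. U \<subseteq> topspace X \<and> U = int_le X (cl_le X U)}"

definition CORO :: "'a topology \<Rightarrow> 'a set set" where
  "CORO X = {U. compactin X U \<and> openin X U \<and> U \<in> RO X}"

definition CORO_at :: "'a topology \<Rightarrow> 'a \<Rightarrow> 'a set set" where
  "CORO_at X x = {U \<in> CORO X. x \<in> U}"

definition is_basis :: "'a topology \<Rightarrow> 'a set set \<Rightarrow> bool" where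
  "is_basis X \<B> \<longleftrightarrow> openin X = arbitrary union_of (\<lambda>U. U \<in> \<B>)"

text \<open>Filters in a family of sets ordered by inclusion and closed under binary intersection, so
  that intersections are the meets. A filter is proper if it is not the whole family; in
  particular an empty space has no proper filters.\<close>

definition is_proper_filter :: "'a set set \<Rightarrow> 'a set set \<Rightarrow> bool" where
  "is_proper_filter B F \<longleftrightarrow>
     F \<subseteq> B \<and> F \<noteq> {} \<and> F \<noteq> B \<and>
     (\<forall>U \<in> F. \<forall>V \<in> F. U \<inter> V \<in> F) \<and>
     (\<forall>U \<in> F. \<forall>V \<in> B. U \<subseteq> V \<longrightarrow> V \<in> F)"

definition UV_space :: "'a topology \<Rightarrow> bool" where
  "UV_space X \<longleftrightarrow>
     t0_space X \<and>
     (\<forall>U \<in> CORO X. \<forall>V \<in> CORO X. U \<inter> V \<in> CORO X) \<and>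
     (\<forall>U \<in> CORO X. int_le X (topspace X - U) \<in> CORO X) \<and>
     is_basis X (CORO X) \<and>
     (\<forall>F. is_proper_filter (CORO X) F \<longrightarrow> (\<exists>x \<in> topspace X. F = CORO_at X x))"


section \<open>Stone locales and their upper Vietoris spaces\<close>

text \<open>The locales of point-free topology are called \<open>frame\<close> here, to avoid confusion with
  Isabelle's locales.\<close>

locale frame = complete_lattice L for L (structure) +
  assumes meet_sup_distrib:
    "\<lbrakk>a \<in> carrier L; Y \<subseteq> carrier L\<rbrakk> \<Longrightarrow> a \<sqinter> \<Squnion>Y = \<Squnion>{a \<sqinter> y | y. y \<in> Y}"

definition complemented :: "('b, 'm) gorder_scheme \<Rightarrow> 'b \<Rightarrow> bool" where
  "complemented L a \<longleftrightarrow> a \<in> carrier L \<and>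
     (\<exists>b \<in> carrier L. a \<sqinter>\<^bsub>L\<^esub> b = \<bottom>\<^bsub>L\<^esub> \<and> a \<squnion>\<^bsub>L\<^esub> b = \<top>\<^bsub>L\<^esub>)"

locale stone_locale = frame +
  assumes compact:
    "\<lbrakk>Y \<subseteq> carrier L; \<Squnion>Y = \<top>\<rbrakk> \<Longrightarrow> \<exists>Y\<^sub>0 \<subseteq> Y. finite Y\<^sub>0 \<and> \<Squnion>Y\<^sub>0 = \<top>"
    and zero_dimensional:
    "a \<in> carrier L \<Longrightarrow> \<exists>Y \<subseteq> {c. complemented L c}. a = \<Squnion>Y"

definition bsquare :: "('b, 'm) gorder_scheme \<Rightarrow> 'b \<Rightarrow> 'b set" where
  "bsquare L x = {y \<in> carrier L - {\<top>\<^bsub>L\<^esub>}. x \<squnion>\<^bsub>L\<^esub> y = \<top>\<^bsub>L\<^esub>}"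

definition upper_vietoris :: "('b, 'm) gorder_scheme \<Rightarrow> 'b topology" where
  "upper_vietoris L = topology_generated_by {bsquare L x | x. x \<in> carrier L}"

text \<open>The point set is left implicit in \<^const>\<open>upper_vietoris\<close>; it is the intended one
  because the top element contributes the whole of it as a generator.\<close>

lemma (in stone_locale) topspace_upper_vietoris:
  "topspace (upper_vietoris L) = carrier L - {\<top>}"
proof -
  have "\<top> \<squnion> y = \<top>" if "y \<in> carrier L" for y
    using that by (meson join_closed join_left le_antisym weak.top_closed weak.top_higher)
  then have "bsquare L \<top> = carrier L - {\<top>}"
    by (auto simp: bsquare_def)
  moreover have "bsquare L x \<subseteq> carrier L - {\<top>}" for x
    by (auto simp: bsquare_def)
  ultimately show ?thesis
    unfolding upper_vietoris_def topology_generated_by_topspace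
    using weak.top_closed by blast
qed

end

theory Submission
  imports Defs
begin

text \<open>
  Points of the upper Vietoris space of a Stone locale are ordered by specialization exactly as
  in the locale, and the compact open regular open sets are the sets of points above a
  complemented element \<open>d\<close>; the complement of \<open>d\<close> yields the negation. A proper filter of such
  sets then corresponds to the join of the complemented elements indexing it.

  Conversely, the proper filters of the Boolean algebra of compact open regular open sets of a
  UV-space \<open>X\<close> are its points, and the improper filter adds a top. Replacing a filter by its
  intersection realizes this as a family of subsets of \<open>X\<close>: the intersections of compact open
  regular open sets, ordered by reverse inclusion, which are the principal upsets and the empty
  set. Joins are intersections, a proper filter having a point is compactness, and the sets that
  are themselves compact open regular open are complemented.
\<close>

section \<open>The upper Vietoris space of a Stone locale\<close>

definition complements :: "('b, 'm) gorder_scheme \<Rightarrow> 'b \<Rightarrow> 'b \<Rightarrow> bool" where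
  "complements L c d \<longleftrightarrow> c \<in> carrier L \<and> d \<in> carrier L \<and>
     c \<sqinter>\<^bsub>L\<^esub> d = \<bottom>\<^bsub>L\<^esub> \<and> c \<squnion>\<^bsub>L\<^esub> d = \<top>\<^bsub>L\<^esub>"

lemma complemented_iff: "complemented L c \<longleftrightarrow> (\<exists>d. complements L c d)"
  by (auto simp: complemented_def complements_def)

lemma complements_sym: "complements L c d \<Longrightarrow> complements L d c"
  by (simp add: complements_def meet_comm join_comm)

lemma complements_complemented:
  assumes "complements L c d"
  shows "complemented L c" "complemented L d"
  using assms complements_sym[OF assms] by (auto simp: complemented_iff)

lemma complements_carrier:
  assumes "complements L c d"
  shows "c \<in> carrier L" "d \<in> carrier L"
  using assms by (auto simp: complements_def)

context frame
begin

lemma meet_join_distrib: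
  assumes "a \<in> carrier L" "b \<in> carrier L" "c \<in> carrier L"
  shows "a \<sqinter> (b \<squnion> c) = (a \<sqinter> b) \<squnion> (a \<sqinter> c)"
proof -
  have "{a \<sqinter> y | y. y \<in> {b, c}} = {a \<sqinter> b, a \<sqinter> c}" by auto
  then show ?thesis
    using meet_sup_distrib[of a "{b, c}"] assms by (simp add: join_def)
qed

lemma join_bottom_right: "x \<in> carrier L \<Longrightarrow> x \<squnion> \<bottom> = x"
  by (metis bottom_closed bottom_lower join_comm le_iff_meet)

lemma top_unique: "x \<in> carrier L \<Longrightarrow> \<top> \<sqsubseteq> x \<Longrightarrow> x = \<top>"
  by (simp add: le_antisym)

text \<open>Meeting \<open>c \<squnion> y = \<top>\<close> with \<open>d\<close> and distributing
  removes \<open>d \<sqinter> c\<close>. Thus the generator \<open>bsquare L c\<close> consists of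
  the points above the complement \<open>d\<close>.\<close>

lemma complements_join_top_iff:
  assumes "complements L c d" "y \<in> carrier L"
  shows "c \<squnion> y = \<top> \<longleftrightarrow> d \<sqsubseteq> y"
proof
  note cd = complements_carrier[OF assms(1)]
  assume "c \<squnion> y = \<top>"
  then have "d = d \<sqinter> (c \<squnion> y)" using cd le_iff_join top_higher by auto
  also have "\<dots> = (d \<sqinter> c) \<squnion> (d \<sqinter> y)" using cd assms by (simp add: meet_join_distrib)
  also have "\<dots> = d \<sqinter> y"
    using assms cd by (simp add: complements_def meet_comm[of L d c] join_comm[of L \<bottom>] join_bottom_right)
  finally show "d \<sqsubseteq> y" using cd assms le_iff_join by auto
next
  note cd = complements_carrier[OF assms(1)]
  assume "d \<sqsubseteq> y"
  then have "c \<squnion> d \<sqsubseteq> c \<squnion> y"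
    by (meson assms(2) cd join_closed join_le join_left join_right le_trans)
  then show "c \<squnion> y = \<top>"
    using assms cd by (intro top_unique) (auto simp: complements_def)
qed

lemma complements_bottom_top: "complements L \<bottom> \<top>"
  by (metis bottom_closed bottom_lower complements_def join_comm join_bottom_right le_iff_join top_closed)

text \<open>De Morgan's law: distributivity splits the meet along \<open>c\<close> and
  \<open>c'\<close>, and splits \<open>d\<close> along \<open>c'\<close> and \<open>d'\<close> for
  the join.\<close>

lemma complements_join:
  assumes "complements L c d" "complements L c' d'"
  shows "complements L (c \<squnion> c') (d \<sqinter> d')"
proof -
  note cd = complements_carrier[OF assms(1)] complements_carrier[OF assms(2)]
  have bot: "z = \<bottom>" if "z \<in> carrier L" "z \<sqsubseteq> \<bottom>" for z
    using that by (simp add: le_antisym)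
  have "(d \<sqinter> d') \<sqinter> c \<sqsubseteq> c \<sqinter> d"
  proof (rule meet_le)
    have "(d \<sqinter> d') \<sqinter> c \<sqsubseteq> d \<sqinter> d'" using cd by (simp add: meet_left)
    also have "d \<sqinter> d' \<sqsubseteq> d" using cd by (simp add: meet_left)
    finally show "(d \<sqinter> d') \<sqinter> c \<sqsubseteq> d" using cd by simp
  qed (use cd in \<open>auto simp: meet_right\<close>)
  moreover have "(d \<sqinter> d') \<sqinter> c' \<sqsubseteq> c' \<sqinter> d'"
  proof (rule meet_le)
    have "(d \<sqinter> d') \<sqinter> c' \<sqsubseteq> d \<sqinter> d'" using cd by (simp add: meet_left)
    also have "d \<sqinter> d' \<sqsubseteq> d'" using cd by (simp add: meet_right)
    finally show "(d \<sqinter> d') \<sqinter> c' \<sqsubseteq> d'" using cd by simp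
  qed (use cd in \<open>auto simp: meet_right\<close>)
  ultimately have 1: "(d \<sqinter> d') \<sqinter> (c \<squnion> c') = \<bottom>"
    using assms cd by (intro bot) (simp_all add: meet_join_distrib join_le complements_def)
  let ?x = "(c \<squnion> c') \<squnion> (d \<sqinter> d')"
  have "d = d \<sqinter> (c' \<squnion> d')"
    using assms(2) cd le_iff_join top_higher by (auto simp: complements_def)
  also have "\<dots> = (d \<sqinter> c') \<squnion> (d \<sqinter> d')" using cd by (simp add: meet_join_distrib)
  also have "\<dots> \<sqsubseteq> ?x"
  proof (rule join_le)
    have "d \<sqinter> c' \<sqsubseteq> c'" using cd by (simp add: meet_right)
    also have "c' \<sqsubseteq> c \<squnion> c'" using cd by (simp add: join_right)
    also have "c \<squnion> c' \<sqsubseteq> ?x" using cd by (simp add: join_left)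
    finally show "d \<sqinter> c' \<sqsubseteq> ?x" using cd by simp
  qed (use cd in \<open>auto simp: join_right\<close>)
  finally have "d \<sqsubseteq> ?x" .
  moreover have "c \<sqsubseteq> ?x"
    using cd le_trans[of c "c \<squnion> c'" ?x] by (simp add: join_left)
  ultimately have "c \<squnion> d \<sqsubseteq> ?x" using cd by (simp add: join_le)
  then have "?x = \<top>"
    using assms cd by (intro top_unique) (auto simp: complements_def)
  with 1 cd show ?thesis by (simp add: complements_def meet_comm)
qed

lemma complemented_join: "complemented L c \<Longrightarrow> complemented L d \<Longrightarrow> complemented L (c \<squnion> d)"
  unfolding complemented_iff using complements_join by blast

lemma sup_insert:
  assumes "a \<in> carrier L" "A \<subseteq> carrier L"
  shows "\<Squnion>(insert a A) = a \<squnion> \<Squnion>A"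
  using weak_sup_insert[OF assms] by (simp add: eq_is_equal)

lemma sup_empty: "\<Squnion>{} = \<bottom>"
  using weak_sup_empty by (simp add: eq_is_equal)

lemma sup_mono:
  assumes "A \<subseteq> B" "B \<subseteq> carrier L"
  shows "\<Squnion>A \<sqsubseteq> \<Squnion>B"
  using assms by (intro sup_least) (auto intro: sup_upper)

lemma complemented_finite_sup:
  assumes "finite A" "A \<subseteq> {c. complemented L c}"
  shows "complemented L (\<Squnion>A)"
  using assms
proof (induction A rule: finite_induct)
  case empty
  then show ?case using complements_bottom_top by (auto simp: sup_empty complemented_iff)
next
  case (insert a A)
  then have "A \<subseteq> carrier L" "a \<in> carrier L" by (auto simp: complemented_def)
  then show ?case
    using insert by (auto simp: sup_insert intro: complemented_join)
qed

end

section \<open>Compactness, zero-dimensionality and the base of the topology\<close>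

context stone_locale
begin

text \<open>Complemented elements inherit compactness from \<open>\<top>\<close>: adding the
  complement \<open>d\<close> to \<open>Y\<close> gives a cover of \<open>\<top>\<close>, and
  \<open>d\<close> is discarded from the finite subcover.\<close>

lemma complemented_le_sup:
  assumes c: "complements L c d" and Y: "Y \<subseteq> carrier L" and le: "c \<sqsubseteq> \<Squnion>Y"
  obtains Y0 where "Y0 \<subseteq> Y" "finite Y0" "c \<sqsubseteq> \<Squnion>Y0"
proof -
  note cd = complements_carrier[OF c]
  have "\<Squnion>(insert d Y) = \<top>"
    using complements_join_top_iff[OF complements_sym[OF c]] Y le cd by (simp add: sup_insert)
  then obtain Y1 where Y1: "Y1 \<subseteq> insert d Y" "finite Y1" "\<Squnion>Y1 = \<top>"
    using compact[of "insert d Y"] Y cd by auto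
  \<comment> \<open>\<open>Y1\<close> may or may not contain \<open>d\<close>; removing and
    reinserting it treats both cases at once.\<close>
  have "\<Squnion>Y1 \<sqsubseteq> \<Squnion>(insert d (Y1 - {d}))"
    using Y1 Y cd by (intro sup_mono) auto
  also have "\<Squnion>(insert d (Y1 - {d})) = d \<squnion> \<Squnion>(Y1 - {d})"
    using Y1 Y cd by (intro sup_insert) auto
  finally have "d \<squnion> \<Squnion>(Y1 - {d}) = \<top>"
    using Y1 Y cd by (intro top_unique join_closed sup_closed) auto
  moreover have "\<Squnion>(Y1 - {d}) \<in> carrier L" using Y1 Y by (intro sup_closed) auto
  ultimately have "c \<sqsubseteq> \<Squnion>(Y1 - {d})"
    using complements_join_top_iff[OF complements_sym[OF c]] by blast
  then show ?thesis using that[of "Y1 - {d}"] Y1 by auto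
qed

text \<open>By zero-dimensionality \<open>x\<close> is the join of complemented elements. This lets
  the open sets detect the order of \<open>L\<close>.\<close>

lemma le_if_complemented_le:
  assumes "x \<in> carrier L" "y \<in> carrier L"
    and "\<And>c. complemented L c \<Longrightarrow> c \<sqsubseteq> x \<Longrightarrow> c \<sqsubseteq> y"
  shows "x \<sqsubseteq> y"
proof -
  obtain Y where Y: "Y \<subseteq> {c. complemented L c}" "x = \<Squnion>Y"
    using zero_dimensional assms(1) by blast
  then have YL: "Y \<subseteq> carrier L" by (auto simp: complemented_def)
  show ?thesis unfolding Y(2)
  proof (rule sup_least[OF YL assms(2)])
    fix c assume "c \<in> Y"
    then show "c \<sqsubseteq> y" using assms(3) Y sup_upper[OF YL] by auto
  qed
qed

text \<open>Compactness cuts the expansion of \<open>x\<close> into complemented elements down to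
  finitely many; their join \<open>c\<close> is complemented, and
  \<open>c \<squnion> y = \<top>\<close> forces its complement below \<open>y\<close>.\<close>

lemma join_top_complemented:
  assumes "x \<in> carrier L" "y \<in> carrier L" "x \<squnion> y = \<top>"
  obtains c d where "complements L c d" "c \<sqsubseteq> x" "d \<sqsubseteq> y"
proof -
  obtain Y where Y: "Y \<subseteq> {c. complemented L c}" "x = \<Squnion>Y"
    using zero_dimensional assms(1) by blast
  then have YL: "Y \<subseteq> carrier L" by (auto simp: complemented_def)
  have "\<Squnion>(insert y Y) = \<top>"
    using assms Y YL by (simp add: sup_insert join_comm)
  then obtain Y1 where Y1: "Y1 \<subseteq> insert y Y" "finite Y1" "\<Squnion>Y1 = \<top>"
    using compact[of "insert y Y"] YL assms by auto
  let ?Z = "Y1 \<inter> Y"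
  have "complemented L (\<Squnion>?Z)" using Y1 Y by (intro complemented_finite_sup) auto
  then obtain d where d: "complements L (\<Squnion>?Z) d" by (auto simp: complemented_iff)
  have ZL: "?Z \<subseteq> carrier L" using YL by auto
  have "\<Squnion>Y1 \<sqsubseteq> \<Squnion>(insert y ?Z)"
    using Y1 assms ZL by (intro sup_mono) auto
  also have "\<Squnion>(insert y ?Z) = \<Squnion>?Z \<squnion> y"
    using assms ZL by (simp add: sup_insert join_comm)
  finally have "\<Squnion>?Z \<squnion> y = \<top>"
    using Y1 assms ZL by (intro top_unique join_closed sup_closed) auto
  then have "d \<sqsubseteq> y" using complements_join_top_iff[OF d] assms by blast
  moreover have "\<Squnion>?Z \<sqsubseteq> x" unfolding Y(2) using YL by (intro sup_mono) auto
  ultimately show ?thesis using that d by blast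
qed

text \<open>The sets of points above complemented elements form a base. Generators are handled by
  \<open>join_top_complemented\<close>; intersections correspond to joins of indices.\<close>

lemma openin_upper_vietoris_iff:
  "openin (upper_vietoris L) S \<longleftrightarrow> S \<subseteq> carrier L - {\<top>} \<and>
     (\<forall>y\<in>S. \<exists>d. complemented L d \<and> d \<sqsubseteq> y \<and> {z \<in> carrier L - {\<top>}. d \<sqsubseteq> z} \<subseteq> S)"
  (is "_ \<longleftrightarrow> _ \<and> (\<forall>y\<in>S. ?P S y)")
proof (intro iffI conjI)
  assume op: "openin (upper_vietoris L) S"
  then show sub: "S \<subseteq> carrier L - {\<top>}"
    using openin_subset topspace_upper_vietoris by blast
  have "generate_topology_on {bsquare L x |x. x \<in> carrier L} S"
    using op unfolding upper_vietoris_def by (rule openin_topology_generated_by)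
  then show "\<forall>y\<in>S. ?P S y"
  proof induction
    case (Int a b)
    show ?case
    proof
      fix y assume y: "y \<in> a \<inter> b"
      obtain d e where d: "complemented L d" "d \<sqsubseteq> y" "{z \<in> carrier L - {\<top>}. d \<sqsubseteq> z} \<subseteq> a"
        and e: "complemented L e" "e \<sqsubseteq> y" "{z \<in> carrier L - {\<top>}. e \<sqsubseteq> z} \<subseteq> b"
        using y Int by (meson IntD1 IntD2)
      \<comment> \<open>The induction hypotheses do not put \<open>y\<close> in the carrier;
        openness of \<open>a\<close> does.\<close>
      have yL: "y \<in> carrier L"
      proof -
        have "openin (upper_vietoris L) a"
          using Int.hyps by (simp add: upper_vietoris_def openin_topology_generated_by_iff)
        then show ?thesis using y openin_subset topspace_upper_vietoris by blast
      qed
      have de: "d \<in> carrier L" "e \<in> carrier L" using d e by (auto simp: complemented_def)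
      have "complemented L (d \<squnion> e)"
        using d(1) e(1) by (rule complemented_join)
      moreover have "d \<squnion> e \<sqsubseteq> y" using d e de yL by (simp add: join_le)
      moreover have "d \<sqsubseteq> z \<and> e \<sqsubseteq> z" if "z \<in> carrier L" "d \<squnion> e \<sqsubseteq> z" for z
        using le_trans[OF join_left that(2)] le_trans[OF join_right that(2)] de that by simp
      then have "{z \<in> carrier L - {\<top>}. d \<squnion> e \<sqsubseteq> z} \<subseteq> a \<inter> b"
        using d(3) e(3) by auto
      ultimately show "?P (a \<inter> b) y" by blast
    qed
  next
    case (UN K)
    then show ?case by (meson Union_iff Union_upper order_trans)
  next
    case (Basis s)
    then obtain x where x: "x \<in> carrier L" "s = bsquare L x" by blast
    show ?case
    proof
      fix y assume "y \<in> s"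
      then have y: "y \<in> carrier L" "x \<squnion> y = \<top>" using x by (auto simp: bsquare_def)
      then obtain c d where cd: "complements L c d" "c \<sqsubseteq> x" "d \<sqsubseteq> y"
        using join_top_complemented x by blast
      note cdL = complements_carrier[OF cd(1)]
      have "x \<squnion> z = \<top>" if "z \<in> carrier L" "d \<sqsubseteq> z" for z
      proof (rule top_unique)
        have "c \<squnion> z = \<top>" using complements_join_top_iff[OF cd(1) that(1)] that(2) by blast
        moreover have "c \<squnion> z \<sqsubseteq> x \<squnion> z"
          using cd(2) cdL x that by (meson join_closed join_le join_left join_right le_trans)
        ultimately show "\<top> \<sqsubseteq> x \<squnion> z" by simp
      qed (use x that in auto)
      then have "{z \<in> carrier L - {\<top>}. d \<sqsubseteq> z} \<subseteq> s"
        using x by (auto simp: bsquare_def)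
      moreover have "complemented L d"
        using cd(1) by (rule complements_complemented)
      ultimately show "?P s y" using cd by blast
    qed
  qed auto
next
  assume A: "S \<subseteq> carrier L - {\<top>} \<and> (\<forall>y\<in>S. ?P S y)"
  have "openin (upper_vietoris L) {z \<in> carrier L - {\<top>}. d \<sqsubseteq> z}" if d: "complemented L d" for d
  proof -
    obtain c where c: "complements L c d" using d complements_sym[of L d] by (auto simp: complemented_iff)
    have "{z \<in> carrier L - {\<top>}. d \<sqsubseteq> z} = bsquare L c"
      using complements_join_top_iff[OF c] by (auto simp: bsquare_def)
    then show ?thesis
      using complements_carrier[OF c] unfolding upper_vietoris_def
      by (metis (mono_tags, lifting) mem_Collect_eq topology_generated_by_Basis)
  qed
  then show "openin (upper_vietoris L) S"
    using A by (subst openin_subopen) blast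
qed

end

text \<open>\<open>cl_le\<close> is \<open>int_le\<close> conjugated by complementation, so regular
  openness means being fixed by the double negation for
  \<open>U \<mapsto> int_le X (topspace X - U)\<close>.\<close>

lemma int_le_cl_le:
  "int_le X (cl_le X U) = int_le X (topspace X - int_le X (topspace X - U))"
  by (auto simp: int_le_def cl_le_def)

lemma int_le_Int: "int_le X (A \<inter> B) = int_le X A \<inter> int_le X B"
  by (auto simp: int_le_def)

text \<open>The argument runs on \<open>X\<close> through the homeomorphism \<open>f\<close>, so no
  separate proof is needed that homeomorphisms preserve UV-spaces.\<close>

locale stone_chart = stone_locale L for L (structure) +
  fixes X :: "'c topology" and f :: "'c \<Rightarrow> 'a"
  assumes homeo: "homeomorphic_map X (upper_vietoris L) f"
begin

section \<open>Base sets, specialization and negation in the charted space\<close>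

definition up_from :: "'a \<Rightarrow> 'c set" where
  "up_from d = {x \<in> topspace X. d \<sqsubseteq> f x}"

lemma image_f: "f ` topspace X = carrier L - {\<top>}"
  using homeomorphic_imp_surjective_map[OF homeo] topspace_upper_vietoris by simp

lemma f_carrier: "x \<in> topspace X \<Longrightarrow> f x \<in> carrier L"
  using image_f by blast

lemma f_not_top: "x \<in> topspace X \<Longrightarrow> f x \<noteq> \<top>"
  using image_f by blast

lemma f_surj:
  assumes "y \<in> carrier L" "y \<noteq> \<top>"
  obtains x where "x \<in> topspace X" "f x = y"
  using image_f assms by (metis Diff_iff imageE singletonD)

lemma openin_iff:
  "openin X W \<longleftrightarrow> W \<subseteq> topspace X \<and>
     (\<forall>x\<in>W. \<exists>d. complemented L d \<and> x \<in> up_from d \<and> up_from d \<subseteq> W)"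
proof (cases "W \<subseteq> topspace X")
  case True
  have "openin X W \<longleftrightarrow> openin (upper_vietoris L) (f ` W)"
    using homeomorphic_map_openness[OF homeo True] by simp
  also have "\<dots> \<longleftrightarrow> (\<forall>x\<in>W. \<exists>d. complemented L d \<and> d \<sqsubseteq> f x \<and>
      {z \<in> carrier L - {\<top>}. d \<sqsubseteq> z} \<subseteq> f ` W)"
    using True image_f unfolding openin_upper_vietoris_iff by blast
  also have "\<dots> \<longleftrightarrow> (\<forall>x\<in>W. \<exists>d. complemented L d \<and> x \<in> up_from d \<and> up_from d \<subseteq> W)"
  proof -
    have "{z \<in> carrier L - {\<top>}. d \<sqsubseteq> z} = f ` up_from d" for d
      using image_f by (auto simp: up_from_def)
    moreover have "f ` up_from d \<subseteq> f ` W \<longleftrightarrow> up_from d \<subseteq> W" for d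
      using inj_on_image_subset_iff[OF homeomorphic_imp_injective_map[OF homeo], of "up_from d" W] True
      by (auto simp: up_from_def)
    ultimately show ?thesis using True by (auto simp: up_from_def)
  qed
  finally show ?thesis using True by simp
qed (use openin_subset in blast)

lemma openin_up_from: "complemented L d \<Longrightarrow> openin X (up_from d)"
  unfolding openin_iff by (auto simp: up_from_def)

text \<open>One direction tests \<open>f x\<close> against complemented elements, whose
  \<open>up_from\<close> sets are open; the other holds because these base sets are upsets.\<close>

lemma spec_le_iff:
  "spec_le X x y \<longleftrightarrow> x \<in> topspace X \<and> y \<in> topspace X \<and> f x \<sqsubseteq> f y"
proof (intro iffI conjI)
  assume le: "spec_le X x y"
  then show xy: "x \<in> topspace X" "y \<in> topspace X" by (auto simp: spec_le_def)
  show "f x \<sqsubseteq> f y"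
  proof (rule le_if_complemented_le)
    fix c assume "complemented L c" "c \<sqsubseteq> f x"
    then show "c \<sqsubseteq> f y"
      using le openin_up_from[of c] by (auto simp: spec_le_def up_from_def)
  qed (use xy f_carrier in auto)
next
  assume A: "x \<in> topspace X \<and> y \<in> topspace X \<and> f x \<sqsubseteq> f y"
  have "y \<in> W" if W: "openin X W" "x \<in> W" for W
  proof -
    obtain d where d: "complemented L d" "x \<in> up_from d" "up_from d \<subseteq> W"
      using W openin_iff by blast
    then have "y \<in> up_from d"
      using A le_trans[of d "f x" "f y"] f_carrier by (auto simp: up_from_def complemented_def)
    then show ?thesis using d by blast
  qed
  then show "spec_le X x y" using A by (auto simp: spec_le_def)
qed

lemma up_from_join:
  assumes "c \<in> carrier L" "d \<in> carrier L"
  shows "up_from (c \<squnion> d) = up_from c \<inter> up_from d"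
proof -
  have "c \<squnion> d \<sqsubseteq> f x \<longleftrightarrow> c \<sqsubseteq> f x \<and> d \<sqsubseteq> f x" if "x \<in> topspace X" for x
  proof
    assume le: "c \<squnion> d \<sqsubseteq> f x"
    show "c \<sqsubseteq> f x \<and> d \<sqsubseteq> f x"
      using le_trans[OF join_left le] le_trans[OF join_right le] assms f_carrier[OF that] by simp
  qed (use assms f_carrier that join_le in auto)
  then show ?thesis by (auto simp: up_from_def)
qed

lemma up_from_bottom: "up_from \<bottom> = topspace X"
  using f_carrier by (auto simp: up_from_def)

lemma up_from_top: "up_from \<top> = {}"
  using f_carrier f_not_top top_unique by (auto simp: up_from_def)

text \<open>If \<open>c \<squnion> f x\<close> is not \<open>\<top>\<close>, it is the image of a
  point above \<open>x\<close> in \<open>up_from c\<close>. So the absence of such points amounts to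
  \<open>c \<squnion> f x = \<top>\<close>, that is, \<open>d \<sqsubseteq> f x\<close>.\<close>

lemma int_le_compl_up_from:
  assumes "complements L c d"
  shows "int_le X (topspace X - up_from c) = up_from d"
proof -
  note cd = complements_carrier[OF assms]
  have "(\<forall>y\<in>topspace X. f x \<sqsubseteq> f y \<longrightarrow> \<not> c \<sqsubseteq> f y) \<longleftrightarrow> d \<sqsubseteq> f x" if x: "x \<in> topspace X" for x
  proof -
    have fx: "f x \<in> carrier L" using f_carrier x .
    have "(\<forall>y\<in>topspace X. f x \<sqsubseteq> f y \<longrightarrow> \<not> c \<sqsubseteq> f y) \<longleftrightarrow> c \<squnion> f x = \<top>"
    proof
      assume A: "\<forall>y\<in>topspace X. f x \<sqsubseteq> f y \<longrightarrow> \<not> c \<sqsubseteq> f y"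
      show "c \<squnion> f x = \<top>"
      proof (rule ccontr)
        assume "c \<squnion> f x \<noteq> \<top>"
        then obtain y where "y \<in> topspace X" "f y = c \<squnion> f x"
          using f_surj[of "c \<squnion> f x"] cd fx by auto
        then show False using A cd fx by (auto simp: join_left join_right)
      qed
    next
      assume top: "c \<squnion> f x = \<top>"
      show "\<forall>y\<in>topspace X. f x \<sqsubseteq> f y \<longrightarrow> \<not> c \<sqsubseteq> f y"
      proof (intro ballI impI notI)
        fix y assume y: "y \<in> topspace X" "f x \<sqsubseteq> f y" "c \<sqsubseteq> f y"
        then have "c \<squnion> f x \<sqsubseteq> f y" using cd fx f_carrier by (auto intro: join_le)
        then show False using top y f_carrier f_not_top top_unique by auto
      qed
    qed
    then show ?thesis using complements_join_top_iff[OF assms fx] by simp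
  qed
  then show ?thesis
    by (auto simp: int_le_def spec_le_iff up_from_def)
qed

text \<open>Negation turns the union into a finite intersection of base sets, which
  \<open>up_from_join\<close> merges into one.\<close>

lemma int_le_compl_Union_up_from:
  assumes "finite D" "D \<subseteq> {d. complemented L d}"
  shows "\<exists>e. complemented L e \<and> int_le X (topspace X - \<Union>(up_from ` D)) = up_from e"
  using assms
proof (induction D rule: finite_induct)
  case empty
  have "int_le X (topspace X) = up_from \<bottom>" by (auto simp: int_le_def up_from_bottom)
  then show ?case using complements_bottom_top by (auto simp: complemented_iff)
next
  case (insert c D)
  then obtain e where e: "complemented L e" "int_le X (topspace X - \<Union>(up_from ` D)) = up_from e"
    by auto
  obtain d where d: "complements L c d" using insert by (auto simp: complemented_iff)
  then have d': "complemented L d" by (rule complements_complemented)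
  have "int_le X (topspace X - \<Union>(up_from ` insert c D)) =
        int_le X (topspace X - up_from c) \<inter> int_le X (topspace X - \<Union>(up_from ` D))"
    unfolding image_insert Union_insert Diff_Un int_le_Int ..
  also have "\<dots> = up_from d \<inter> up_from e"
    unfolding e(2) int_le_compl_up_from[OF d] ..
  also have "\<dots> = up_from (d \<squnion> e)"
    using e(1) d' by (intro up_from_join[symmetric]) (auto simp: complemented_def)
  finally show ?case using complemented_join[OF d' e(1)] by blast
qed

section \<open>Compact open regular open sets and their filters\<close>

lemma compactin_up_from:
  assumes "complemented L d"
  shows "compactin X (up_from d)"
proof (cases "d = \<top>")
  case False
  then obtain x where x: "x \<in> topspace X" "f x = d"
    using f_surj assms by (auto simp: complemented_def)
  have "\<exists>\<F>. finite \<F> \<and> \<F> \<subseteq> \<U> \<and> up_from d \<subseteq> \<Union>\<F>"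
    if \<U>: "\<forall>U\<in>\<U>. openin X U" "up_from d \<subseteq> \<Union>\<U>" for \<U>
  proof -
    \<comment> \<open>\<open>x\<close> is the least point of \<open>up_from d\<close> and open sets
      are upsets, so one cover member containing \<open>x\<close> suffices.\<close>
    have "x \<in> up_from d" using x f_carrier[OF x(1)] by (auto simp: up_from_def)
    then obtain U where U: "U \<in> \<U>" "x \<in> U" using \<U> by blast
    have "up_from d \<subseteq> U"
    proof
      fix y assume "y \<in> up_from d"
      then have "spec_le X x y" using x by (auto simp: up_from_def spec_le_iff)
      then show "y \<in> U" using U \<U> by (auto simp: spec_le_def)
    qed
    then show ?thesis using U by (intro exI[of _ "{U}"]) auto
  qed
  then show ?thesis by (auto simp: compactin_def up_from_def)
qed (simp add: up_from_top)

lemma CORO_eq: "CORO X = up_from ` {d. complemented L d}"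
proof (intro equalityI subsetI)
  fix U assume "U \<in> up_from ` {d. complemented L d}"
  then obtain d where d: "complemented L d" "U = up_from d" by blast
  then obtain c where c: "complements L d c" by (auto simp: complemented_iff)
  have "U \<subseteq> topspace X" using d(2) by (auto simp: up_from_def)
  moreover have "int_le X (cl_le X U) = U"
    by (simp add: int_le_cl_le d(2) int_le_compl_up_from[OF c]
      int_le_compl_up_from[OF complements_sym[OF c]])
  ultimately have "U \<in> RO X" by (simp add: RO_def)
  then show "U \<in> CORO X"
    using d openin_up_from compactin_up_from by (auto simp: CORO_def)
next
  fix U assume U: "U \<in> CORO X"
  \<comment> \<open>Cover \<open>U\<close> by the base sets inside it. Compactness makes
    \<open>U\<close> a finite union of them, and regularity equates \<open>U\<close> with the double
    negation of that union, a single \<open>up_from e'\<close>.\<close>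
  let ?\<U> = "up_from ` {d. complemented L d \<and> up_from d \<subseteq> U}"
  have "U \<subseteq> \<Union>?\<U>"
  proof
    fix x assume "x \<in> U"
    then obtain d where "complemented L d" "x \<in> up_from d" "up_from d \<subseteq> U"
      using U openin_iff by (auto simp: CORO_def)
    then show "x \<in> \<Union>?\<U>" by blast
  qed
  moreover have "\<forall>V\<in>?\<U>. openin X V" using openin_up_from by blast
  ultimately obtain \<F> where \<F>: "finite \<F>" "\<F> \<subseteq> ?\<U>" "U \<subseteq> \<Union>\<F>"
    using U unfolding CORO_def compactin_def by blast
  then obtain D where D: "finite D" "D \<subseteq> {d. complemented L d \<and> up_from d \<subseteq> U}" "\<F> = up_from ` D"
    using finite_subset_image[OF \<F>(1,2)] by blast
  then have "U = \<Union>(up_from ` D)" using \<F> by blast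
  moreover obtain e where e: "complemented L e"
    "int_le X (topspace X - \<Union>(up_from ` D)) = up_from e"
    using int_le_compl_Union_up_from[of D] D by blast
  moreover obtain e' where e': "complements L e e'" using e by (auto simp: complemented_iff)
  moreover have "U = int_le X (cl_le X U)" using U by (auto simp: CORO_def RO_def)
  ultimately have "U = up_from e'"
    using int_le_compl_up_from[OF e'] int_le_cl_le[of X U] by metis
  then show "U \<in> up_from ` {d. complemented L d}"
    using complements_complemented[OF e'] by blast
qed

lemma proper_filter_at_point:
  assumes "is_proper_filter (CORO X) F"
  obtains x where "x \<in> topspace X" "F = CORO_at X x"
proof -
  have F: "F \<subseteq> CORO X" "F \<noteq> {}" "F \<noteq> CORO X" and
    F_Int: "\<And>U V. U \<in> F \<Longrightarrow> V \<in> F \<Longrightarrow> U \<inter> V \<in> F" and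
    F_up: "\<And>U V. U \<in> F \<Longrightarrow> V \<in> CORO X \<Longrightarrow> U \<subseteq> V \<Longrightarrow> V \<in> F"
    using assms by (auto simp: is_proper_filter_def)
  define I where "I = {d. complemented L d \<and> up_from d \<in> F}"
  have IL: "I \<subseteq> carrier L" by (auto simp: I_def complemented_def)
  have fin: "up_from (\<Squnion>D) \<in> F" if "finite D" "D \<subseteq> I" for D
    using that
  proof (induction D rule: finite_induct)
    \<comment> \<open>The empty join \<open>\<bottom>\<close> stands for the whole space, which is
      in \<open>F\<close> because \<open>F\<close> is nonempty and upward closed.\<close>
    case empty
    obtain U where "U \<in> F" using F by blast
    moreover from this have "U \<subseteq> topspace X" using F by (auto simp: CORO_eq up_from_def)
    moreover have "up_from \<bottom> \<in> CORO X"
      using complements_bottom_top by (auto simp: CORO_eq complemented_iff)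
    ultimately show ?case using F_up by (simp add: sup_empty up_from_bottom)
  next
    case (insert d D)
    moreover have "d \<in> carrier L" "D \<subseteq> carrier L" "up_from d \<in> F"
      using insert IL by (auto simp: I_def)
    ultimately show ?case using F_Int by (simp add: sup_insert up_from_join)
  qed
  \<comment> \<open>Passing to the join adds no new sets to the filter:
    \<open>complemented_le_sup\<close> replaces \<open>I\<close> by a finite subset, and
    \<open>fin\<close> applies.\<close>
  have mem: "up_from d \<in> F \<longleftrightarrow> d \<sqsubseteq> \<Squnion>I" if d: "complemented L d" for d
  proof
    assume "up_from d \<in> F"
    then show "d \<sqsubseteq> \<Squnion>I" using d IL by (intro sup_upper) (auto simp: I_def)
  next
    assume "d \<sqsubseteq> \<Squnion>I"
    moreover obtain c where "complements L d c" using d by (auto simp: complemented_iff)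
    ultimately obtain D where D: "D \<subseteq> I" "finite D" "d \<sqsubseteq> \<Squnion>D"
      using complemented_le_sup IL by blast
    have "up_from (\<Squnion>D) \<subseteq> up_from d"
    proof
      fix x assume "x \<in> up_from (\<Squnion>D)"
      then show "x \<in> up_from d"
        using D IL d f_carrier le_trans[OF D(3), of "f x"] sup_closed[of D]
        by (auto simp: up_from_def complemented_def)
    qed
    then show "up_from d \<in> F" using fin D F_up[of "up_from (\<Squnion>D)"] d CORO_eq by auto
  qed
  \<comment> \<open>Here properness enters: a join equal to \<open>\<top>\<close> would bring every
    base set into \<open>F\<close>.\<close>
  have "\<Squnion>I \<noteq> \<top>"
  proof
    assume "\<Squnion>I = \<top>"
    then have "CORO X \<subseteq> F" using mem by (auto simp: CORO_eq complemented_def)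
    then show False using F by blast
  qed
  then obtain x where x: "x \<in> topspace X" "f x = \<Squnion>I" using f_surj[of "\<Squnion>I"] IL by auto
  have "F = CORO_at X x"
  proof (rule Set.set_eqI)
    fix U
    show "U \<in> F \<longleftrightarrow> U \<in> CORO_at X x"
    proof (cases "U \<in> CORO X")
      case True
      then obtain d where "complemented L d" "U = up_from d" by (auto simp: CORO_eq)
      then show ?thesis using True mem[of d] x by (simp add: CORO_at_def up_from_def)
    qed (use F(1) in \<open>auto simp: CORO_at_def\<close>)
  qed
  then show ?thesis using x that by blast
qed

lemma UV_space_chart: "UV_space X"
proof -
  have "t0_space X"
    unfolding t0_space_def
  proof (intro ballI impI)
    fix x y assume xy: "x \<in> topspace X" "y \<in> topspace X" "x \<noteq> y"
    then have "f x \<noteq> f y"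
      using homeomorphic_imp_injective_map[OF homeo] by (auto dest: inj_onD)
    \<comment> \<open>Mutual specialization would force \<open>f x = f y\<close> by antisymmetry in
      \<open>L\<close>.\<close>
    then have "\<not> (spec_le X x y \<and> spec_le X y x)"
      using xy f_carrier le_antisym by (auto simp: spec_le_iff)
    then show "\<exists>U. openin X U \<and> (x \<notin> U \<longleftrightarrow> y \<in> U)"
      using xy unfolding spec_le_def by blast
  qed
  moreover have "U \<inter> V \<in> CORO X" if UV: "U \<in> CORO X" "V \<in> CORO X" for U V
  proof -
    obtain c d where "complemented L c" "complemented L d" "U = up_from c" "V = up_from d"
      using UV by (auto simp: CORO_eq)
    then have "complemented L (c \<squnion> d)" "U \<inter> V = up_from (c \<squnion> d)"
      by (auto intro: complemented_join) (auto simp: up_from_join complemented_def)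
    then show ?thesis by (auto simp: CORO_eq)
  qed
  moreover have "int_le X (topspace X - U) \<in> CORO X" if U: "U \<in> CORO X" for U
  proof -
    obtain c d where "complements L c d" "U = up_from c"
      using U unfolding CORO_eq complemented_iff by blast
    then have "int_le X (topspace X - U) = up_from d" "complemented L d"
      using int_le_compl_up_from complements_complemented by auto
    then show ?thesis by (auto simp: CORO_eq)
  qed
  moreover have "is_basis X (CORO X)"
    unfolding is_basis_def openin_topology_base_unique
  proof (intro conjI allI impI)
    fix U x assume "openin X U \<and> x \<in> U"
    then show "\<exists>V. V \<in> CORO X \<and> x \<in> V \<and> V \<subseteq> U"
      unfolding CORO_eq openin_iff[of U] by blast
  qed (simp add: CORO_def)
  ultimately show ?thesis
    unfolding UV_space_def using proper_filter_at_point by metis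
qed

end

lemma UV_space_upper_vietoris:
  assumes "stone_locale L" "X homeomorphic_space upper_vietoris L"
  shows "UV_space X"
proof -
  obtain f where "homeomorphic_map X (upper_vietoris L) f"
    using assms(2) by (auto simp: homeomorphic_space)
  then interpret stone_chart L X f
    using assms(1) by (intro stone_chart.intro stone_chart_axioms.intro)
  show ?thesis by (rule UV_space_chart)
qed

section \<open>The Stone locale of a UV-space\<close>

definition spec_up :: "'a topology \<Rightarrow> 'a \<Rightarrow> 'a set" where
  "spec_up X x = {y. spec_le X x y}"

text \<open>These are the intersections, taken within \<open>topspace X\<close>, of subfamilies of
  \<open>CORO X\<close>. The pointwise form includes the empty family, which gives the whole
  space.\<close>

definition coro_closed :: "'a topology \<Rightarrow> 'a set set" where
  "coro_closed X =
     {a. a \<subseteq> topspace X \<and> (\<forall>x \<in> topspace X - a. \<exists>U \<in> CORO X. a \<subseteq> U \<and> x \<notin> U)}"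

text \<open>The closure operator with fixed points \<open>coro_closed X\<close>; meets in the
  lattice are hulls of unions.\<close>

definition coro_hull :: "'a topology \<Rightarrow> 'a set \<Rightarrow> 'a set" where
  "coro_hull X A = {x \<in> topspace X. \<forall>U \<in> CORO X. A \<subseteq> U \<longrightarrow> x \<in> U}"

definition coro_frame :: "'a topology \<Rightarrow> 'a set gorder" where
  "coro_frame X = \<lparr>carrier = coro_closed X, eq = (=), le = (\<lambda>a b. b \<subseteq> a)\<rparr>"

lemma spec_le_refl: "x \<in> topspace X \<Longrightarrow> spec_le X x x"
  by (simp add: spec_le_def)

lemma mem_spec_up: "x \<in> topspace X \<Longrightarrow> x \<in> spec_up X x"
  by (simp add: spec_up_def spec_le_refl)

lemma spec_le_trans: "spec_le X x y \<Longrightarrow> spec_le X y z \<Longrightarrow> spec_le X x z"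
  by (simp add: spec_le_def)

lemma CORO_subset: "U \<in> CORO X \<Longrightarrow> U \<subseteq> topspace X"
  by (auto simp: CORO_def RO_def)

lemma CORO_upset: "U \<in> CORO X \<Longrightarrow> x \<in> U \<Longrightarrow> spec_le X x y \<Longrightarrow> y \<in> U"
  by (auto simp: CORO_def spec_le_def)

lemma empty_in_CORO: "{} \<in> CORO X"
  by (auto simp: CORO_def RO_def int_le_def cl_le_def intro: spec_le_refl)

lemma CORO_neg_neg: "U \<in> CORO X \<Longrightarrow> int_le X (topspace X - int_le X (topspace X - U)) = U"
  by (simp add: CORO_def RO_def flip: int_le_cl_le)

lemma CORO_disjoint_neg: "U \<inter> int_le X (topspace X - U) = {}"
  by (auto simp: int_le_def intro: spec_le_refl)

text \<open>\<open>int_le X (topspace X - V)\<close> is the largest upset avoiding \<open>V\<close>,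
  and \<open>U\<close> is such an upset.\<close>

lemma CORO_subset_neg:
  assumes "U \<in> CORO X" "U \<inter> V = {}"
  shows "U \<subseteq> int_le X (topspace X - V)"
  using assms CORO_subset CORO_upset by (fastforce simp: int_le_def)

lemma coro_closed_subset: "a \<in> coro_closed X \<Longrightarrow> a \<subseteq> topspace X"
  by (simp add: coro_closed_def)

lemma coro_closedI:
  assumes "a \<subseteq> topspace X"
    and "\<And>x. x \<in> topspace X \<Longrightarrow> x \<notin> a \<Longrightarrow> \<exists>U \<in> CORO X. a \<subseteq> U \<and> x \<notin> U"
  shows "a \<in> coro_closed X"
  using assms by (simp add: coro_closed_def)

lemma coro_closed_separate:
  assumes "a \<in> coro_closed X" "x \<in> topspace X" "x \<notin> a"
  shows "\<exists>U \<in> CORO X. a \<subseteq> U \<and> x \<notin> U"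
  using assms by (simp add: coro_closed_def)

lemma CORO_in_coro_closed: "U \<in> CORO X \<Longrightarrow> U \<in> coro_closed X"
  using CORO_subset by (intro coro_closedI) auto

lemma Inter_in_coro_closed:
  assumes "Y \<subseteq> coro_closed X"
  shows "topspace X \<inter> \<Inter>Y \<in> coro_closed X"
proof (rule coro_closedI)
  fix x assume x: "x \<in> topspace X" "x \<notin> topspace X \<inter> \<Inter>Y"
  then obtain a where a: "a \<in> Y" "x \<notin> a" by blast
  obtain U where "U \<in> CORO X" "a \<subseteq> U" "x \<notin> U"
    using coro_closed_separate[of a X x] a x assms by blast
  moreover have "topspace X \<inter> \<Inter>Y \<subseteq> a" using a by blast
  ultimately show "\<exists>U \<in> CORO X. topspace X \<inter> \<Inter>Y \<subseteq> U \<and> x \<notin> U" by (meson subset_trans)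
qed simp

lemma coro_hullI:
  "x \<in> topspace X \<Longrightarrow> (\<And>U. U \<in> CORO X \<Longrightarrow> A \<subseteq> U \<Longrightarrow> x \<in> U) \<Longrightarrow> x \<in> coro_hull X A"
  by (simp add: coro_hull_def)

lemma coro_hullD: "x \<in> coro_hull X A \<Longrightarrow> U \<in> CORO X \<Longrightarrow> A \<subseteq> U \<Longrightarrow> x \<in> U"
  by (simp add: coro_hull_def)

lemma coro_hull_closed: "coro_hull X A \<in> coro_closed X"
proof (rule coro_closedI)
  fix x assume "x \<in> topspace X" "x \<notin> coro_hull X A"
  then obtain U where U: "U \<in> CORO X" "A \<subseteq> U" "x \<notin> U" by (auto simp: coro_hull_def)
  moreover have "coro_hull X A \<subseteq> U" using coro_hullD[OF _ U(1,2)] by blast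
  ultimately show "\<exists>U \<in> CORO X. coro_hull X A \<subseteq> U \<and> x \<notin> U" by blast
qed (auto simp: coro_hull_def)

lemma coro_hull_mono: "A \<subseteq> B \<Longrightarrow> coro_hull X A \<subseteq> coro_hull X B"
  by (auto simp: coro_hull_def)

lemma subset_coro_hull: "A \<subseteq> topspace X \<Longrightarrow> A \<subseteq> coro_hull X A"
  by (auto simp: coro_hull_def)

lemma coro_hull_least:
  assumes "a \<in> coro_closed X" "A \<subseteq> a"
  shows "coro_hull X A \<subseteq> a"
proof
  fix x assume x: "x \<in> coro_hull X A"
  show "x \<in> a"
  proof (rule ccontr)
    assume "x \<notin> a"
    moreover have "x \<in> topspace X" using x by (simp add: coro_hull_def)
    ultimately obtain U where "U \<in> CORO X" "a \<subseteq> U" "x \<notin> U"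
      using coro_closed_separate[OF assms(1)] by blast
    then show False using coro_hullD[OF x, of U] assms(2) by blast
  qed
qed

lemma coro_frame_sel [simp]:
  "carrier (coro_frame X) = coro_closed X"
  "a \<sqsubseteq>\<^bsub>coro_frame X\<^esub> b \<longleftrightarrow> b \<subseteq> a"
  "a .=\<^bsub>coro_frame X\<^esub> b \<longleftrightarrow> a = b"
  by (simp_all add: coro_frame_def)

lemma partial_order_coro_frame: "partial_order (coro_frame X)"
  by unfold_locales (auto simp: fun_eq_iff)

lemma lub_coro_frame:
  assumes "Y \<subseteq> coro_closed X"
  shows "least (coro_frame X) (topspace X \<inter> \<Inter>Y) (Upper (coro_frame X) Y)"
proof -
  have "y \<subseteq> topspace X \<inter> \<Inter>Y" if "y \<in> Upper (coro_frame X) Y" for y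
    using that assms coro_closed_subset unfolding Upper_def coro_frame_sel by blast
  then show ?thesis
    using Inter_in_coro_closed[OF assms] unfolding least_def by (auto simp: Upper_def)
qed

lemma glb_coro_frame:
  assumes "Y \<subseteq> coro_closed X"
  shows "greatest (coro_frame X) (coro_hull X (\<Union>Y)) (Lower (coro_frame X) Y)"
proof -
  have "\<Union>Y \<subseteq> coro_hull X (\<Union>Y)"
    using assms coro_closed_subset by (intro subset_coro_hull) blast
  moreover have "coro_hull X (\<Union>Y) \<subseteq> y" if "y \<in> Lower (coro_frame X) Y" for y
  proof (rule coro_hull_least)
    show "y \<in> coro_closed X" using that by (simp add: Lower_def)
    show "\<Union>Y \<subseteq> y" using that assms unfolding Lower_def coro_frame_sel by blast
  qed
  ultimately show ?thesis
    using assms coro_hull_closed by (intro greatest_LowerI) auto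
qed

lemma complete_lattice_coro_frame: "complete_lattice (coro_frame X)"
proof -
  interpret partial_order "coro_frame X" by (rule partial_order_coro_frame)
  show ?thesis
    using lub_coro_frame[of _ X] glb_coro_frame[of _ X] by (intro complete_latticeI) auto
qed

lemma sup_coro_frame: "Y \<subseteq> coro_closed X \<Longrightarrow> \<Squnion>\<^bsub>coro_frame X\<^esub>Y = topspace X \<inter> \<Inter>Y"
proof -
  interpret complete_lattice "coro_frame X" by (rule complete_lattice_coro_frame)
  show "Y \<subseteq> coro_closed X \<Longrightarrow> \<Squnion>\<^bsub>coro_frame X\<^esub>Y = topspace X \<inter> \<Inter>Y"
    using sup_lub[of Y] lub_coro_frame[of Y X] least_unique by simp
qed

lemma inf_coro_frame: "Y \<subseteq> coro_closed X \<Longrightarrow> \<Sqinter>\<^bsub>coro_frame X\<^esub>Y = coro_hull X (\<Union>Y)"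
proof -
  interpret complete_lattice "coro_frame X" by (rule complete_lattice_coro_frame)
  show "Y \<subseteq> coro_closed X \<Longrightarrow> \<Sqinter>\<^bsub>coro_frame X\<^esub>Y = coro_hull X (\<Union>Y)"
    using inf_glb[of Y] glb_coro_frame[of Y X] greatest_unique by simp
qed

lemma join_coro_frame:
  "a \<in> coro_closed X \<Longrightarrow> b \<in> coro_closed X \<Longrightarrow> a \<squnion>\<^bsub>coro_frame X\<^esub> b = a \<inter> b"
  using coro_closed_subset by (simp add: join_def sup_coro_frame) blast

lemma meet_coro_frame:
  "a \<in> coro_closed X \<Longrightarrow> b \<in> coro_closed X \<Longrightarrow> a \<sqinter>\<^bsub>coro_frame X\<^esub> b = coro_hull X (a \<union> b)"
  by (simp add: meet_def inf_coro_frame)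

lemma top_coro_frame: "\<top>\<^bsub>coro_frame X\<^esub> = {}"
proof -
  interpret complete_lattice "coro_frame X" by (rule complete_lattice_coro_frame)
  have "{} \<in> coro_closed X" using CORO_in_coro_closed empty_in_CORO by blast
  then show ?thesis using top_higher[of "{}"] by simp
qed

lemma bottom_coro_frame: "\<bottom>\<^bsub>coro_frame X\<^esub> = topspace X"
proof -
  interpret complete_lattice "coro_frame X" by (rule complete_lattice_coro_frame)
  have "topspace X \<in> coro_closed X" by (simp add: coro_closed_def)
  moreover have "\<bottom>\<^bsub>coro_frame X\<^esub> \<in> coro_closed X" using bottom_closed by simp
  ultimately show ?thesis using bottom_lower[of "topspace X"] by (simp add: coro_closed_def)
qed

section \<open>Filters, compactness and separation in a UV-space\<close>

locale uv_space =
  fixes X :: "'a topology"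
  assumes uv: "UV_space X"
begin

abbreviation "neg U \<equiv> int_le X (topspace X - U)"

lemma CORO_Int: "U \<in> CORO X \<Longrightarrow> V \<in> CORO X \<Longrightarrow> U \<inter> V \<in> CORO X"
  using uv by (simp add: UV_space_def)

lemma CORO_neg: "U \<in> CORO X \<Longrightarrow> neg U \<in> CORO X"
  using uv by (simp add: UV_space_def)

lemma topspace_in_CORO: "topspace X \<in> CORO X"
proof -
  have "neg {} = topspace X" by (auto simp: int_le_def)
  then show ?thesis using CORO_neg[OF empty_in_CORO] by simp
qed

lemma CORO_base:
  assumes "openin X W" "x \<in> W"
  obtains U where "U \<in> CORO X" "x \<in> U" "U \<subseteq> W"
proof -
  have "openin X = arbitrary union_of (\<lambda>U. U \<in> CORO X)"
    using uv by (simp add: UV_space_def is_basis_def)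
  then have "\<exists>U. U \<in> CORO X \<and> x \<in> U \<and> U \<subseteq> W"
    using assms unfolding openin_topology_base_unique by simp
  then show ?thesis using that by blast
qed

text \<open>Avoiding \<open>{}\<close> is what witnesses properness, since \<open>{}\<close> always
  belongs to \<open>CORO X\<close>.\<close>

lemma proper_filter_at_point:
  assumes "F \<subseteq> CORO X" "topspace X \<in> F" "{} \<notin> F"
    and "\<And>U V. U \<in> F \<Longrightarrow> V \<in> F \<Longrightarrow> U \<inter> V \<in> F"
    and "\<And>U V. U \<in> F \<Longrightarrow> V \<in> CORO X \<Longrightarrow> U \<subseteq> V \<Longrightarrow> V \<in> F"
  obtains x where "x \<in> topspace X" "F = CORO_at X x"
proof -
  have "is_proper_filter (CORO X) F"
    unfolding is_proper_filter_def
  proof (intro conjI ballI impI)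
    show "F \<noteq> CORO X" using assms(3) empty_in_CORO by blast
  qed (use assms in auto)
  then have "\<exists>x \<in> topspace X. F = CORO_at X x" using uv by (simp add: UV_space_def)
  then show ?thesis using that by blast
qed

text \<open>Were all finite intersections nonempty, the filter generated by \<open>G\<close> would
  be proper, and its point would lie in every member of \<open>G\<close>.\<close>

lemma CORO_compactness:
  assumes G: "G \<subseteq> CORO X" and empty: "topspace X \<inter> \<Inter>G = {}"
  shows "\<exists>G0. finite G0 \<and> G0 \<subseteq> G \<and> topspace X \<inter> \<Inter>G0 = {}"
proof (rule ccontr)
  assume "\<nexists>G0. finite G0 \<and> G0 \<subseteq> G \<and> topspace X \<inter> \<Inter>G0 = {}"
  then have none: "topspace X \<inter> \<Inter>G0 \<noteq> {}" if "finite G0" "G0 \<subseteq> G" for G0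
    using that by blast
  define F where "F = {U \<in> CORO X. \<exists>G0. finite G0 \<and> G0 \<subseteq> G \<and> topspace X \<inter> \<Inter>G0 \<subseteq> U}"
  obtain x where x: "x \<in> topspace X" "F = CORO_at X x"
  proof (rule proper_filter_at_point[of F])
    show "topspace X \<in> F"
      using topspace_in_CORO by (auto simp: F_def intro!: exI[of _ "{}"])
    show "U \<inter> V \<in> F" if UV: "U \<in> F" "V \<in> F" for U V
    proof -
      obtain A B where "finite A" "A \<subseteq> G" "topspace X \<inter> \<Inter>A \<subseteq> U"
          "finite B" "B \<subseteq> G" "topspace X \<inter> \<Inter>B \<subseteq> V"
        using UV by (auto simp: F_def)
      then have "finite (A \<union> B) \<and> A \<union> B \<subseteq> G \<and> topspace X \<inter> \<Inter>(A \<union> B) \<subseteq> U \<inter> V"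
        by auto
      moreover have "U \<inter> V \<in> CORO X" using UV CORO_Int by (simp add: F_def)
      ultimately show ?thesis unfolding F_def by blast
    qed
    show "V \<in> F" if UV: "U \<in> F" "V \<in> CORO X" "U \<subseteq> V" for U V
    proof -
      obtain A where "finite A \<and> A \<subseteq> G \<and> topspace X \<inter> \<Inter>A \<subseteq> U"
        using UV(1) unfolding F_def by blast
      then have "finite A \<and> A \<subseteq> G \<and> topspace X \<inter> \<Inter>A \<subseteq> V"
        using UV(3) by (meson subset_trans)
      then show ?thesis using UV(2) unfolding F_def by blast
    qed
  qed (use none in \<open>auto simp: F_def\<close>)
  have "G \<subseteq> F"
  proof
    fix U assume "U \<in> G"
    then show "U \<in> F" using G unfolding F_def by (intro CollectI conjI exI[of _ "{U}"]) auto
  qed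
  then show False using x empty by (auto simp: CORO_at_def)
qed

text \<open>Since \<open>CORO X\<close> is a base, a point not above \<open>x\<close> is missed by
  some member containing \<open>x\<close>; being an upset, that member contains all of
  \<open>spec_up X x\<close>.\<close>

lemma spec_up_coro_closed:
  assumes x: "x \<in> topspace X"
  shows "spec_up X x \<in> coro_closed X"
  unfolding spec_up_def
proof (rule coro_closedI)
  fix y assume y: "y \<in> topspace X" "y \<notin> {y. spec_le X x y}"
  with x obtain W where "openin X W" "x \<in> W" "y \<notin> W" by (auto simp: spec_le_def)
  then obtain U where "U \<in> CORO X" "x \<in> U" "y \<notin> U" using CORO_base by blast
  moreover from this have "{y. spec_le X x y} \<subseteq> U" using CORO_upset[of U X x] by blast
  ultimately show "\<exists>U\<in>CORO X. {y. spec_le X x y} \<subseteq> U \<and> y \<notin> U" by blast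
qed (auto simp: spec_le_def)

lemma spec_up_subset_iff: "x \<in> topspace X \<Longrightarrow> U \<in> CORO X \<Longrightarrow> spec_up X x \<subseteq> U \<longleftrightarrow> x \<in> U"
  using CORO_upset[of U X x] spec_le_refl[of x X] by (auto simp: spec_up_def)

text \<open>The supersets of \<open>a\<close> in \<open>CORO X\<close> form a proper filter. Its
  point \<open>x\<close> gives \<open>spec_up X x\<close> the same supersets in
  \<open>CORO X\<close>, and these determine a member of \<open>coro_closed X\<close>.\<close>

lemma coro_closed_eq_spec_up:
  assumes a: "a \<in> coro_closed X" "a \<noteq> {}"
  obtains x where "x \<in> topspace X" "a = spec_up X x"
proof -
  define F where "F = {U \<in> CORO X. a \<subseteq> U}"
  obtain x where x: "x \<in> topspace X" "F = CORO_at X x"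
  proof (rule proper_filter_at_point[of F])
    show "topspace X \<in> F"
      using topspace_in_CORO coro_closed_subset[OF a(1)] by (simp add: F_def)
  qed (use a CORO_Int in \<open>auto simp: F_def\<close>)
  then have iff: "a \<subseteq> U \<longleftrightarrow> spec_up X x \<subseteq> U" if "U \<in> CORO X" for U
    using that x spec_up_subset_iff[OF x(1) that] by (auto simp: F_def CORO_at_def)
  have "a = spec_up X x"
  proof (rule subset_antisym; rule subsetI; rule ccontr)
    fix y assume y: "y \<in> a" "y \<notin> spec_up X x"
    then obtain U where "U \<in> CORO X" "spec_up X x \<subseteq> U" "y \<notin> U"
      using coro_closed_separate[OF spec_up_coro_closed[OF x(1)]] coro_closed_subset[OF a(1)] by blast
    then show False using iff y by blast
  next
    fix y assume y: "y \<in> spec_up X x" "y \<notin> a"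
    then obtain U where "U \<in> CORO X" "a \<subseteq> U" "y \<notin> U"
      using coro_closed_separate[OF a(1)] coro_closed_subset[OF spec_up_coro_closed[OF x(1)]] by blast
    then show False using iff y by blast
  qed
  then show ?thesis using x that by blast
qed

lemma coro_closed_upset:
  assumes "a \<in> coro_closed X" "x \<in> a" "spec_le X x y"
  shows "y \<in> a"
proof (rule ccontr)
  assume "y \<notin> a"
  moreover have "y \<in> topspace X" using assms(3) by (simp add: spec_le_def)
  ultimately obtain U where U: "U \<in> CORO X" "a \<subseteq> U" "y \<notin> U"
    using coro_closed_separate[OF assms(1)] by blast
  then show False using CORO_upset[OF U(1) _ assms(3)] assms(2) by blast
qed

text \<open>Apply \<open>CORO_compactness\<close> to the sets in \<open>CORO X\<close> that contain
  a member of \<open>Y\<close>, then pick a member of \<open>Y\<close> inside each of the finitely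
  many sets kept.\<close>

lemma coro_closed_compactness:
  assumes Y: "Y \<subseteq> coro_closed X" and empty: "topspace X \<inter> \<Inter>Y = {}"
  obtains Y0 where "finite Y0" "Y0 \<subseteq> Y" "topspace X \<inter> \<Inter>Y0 = {}"
proof -
  define G where "G = {U \<in> CORO X. \<exists>a\<in>Y. a \<subseteq> U}"
  have "topspace X \<inter> \<Inter>G = {}"
  proof (rule ccontr)
    assume "topspace X \<inter> \<Inter>G \<noteq> {}"
    then obtain x where x: "x \<in> topspace X" "x \<in> \<Inter>G" by blast
    then obtain a where "a \<in> Y" "x \<notin> a" using empty by blast
    moreover from this obtain U where "U \<in> CORO X" "a \<subseteq> U" "x \<notin> U"
      using x Y coro_closed_separate[of a X x] by blast
    ultimately show False using x by (auto simp: G_def)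
  qed
  then obtain G0 where G0: "finite G0" "G0 \<subseteq> G" "topspace X \<inter> \<Inter>G0 = {}"
    using CORO_compactness[of G] unfolding G_def by blast
  have "\<forall>U\<in>G0. \<exists>a. a \<in> Y \<and> a \<subseteq> U" using G0 by (auto simp: G_def)
  then obtain g where g: "\<And>U. U \<in> G0 \<Longrightarrow> g U \<in> Y \<and> g U \<subseteq> U" by metis
  show ?thesis
    using G0 g by (intro that[of "g ` G0"]) (auto, blast)
qed

text \<open>The supersets of \<open>a\<close> or of \<open>b\<close> in \<open>CORO X\<close> have
  no common point, so finitely many of them already have none; intersect those around
  \<open>a\<close> and those around \<open>b\<close>.\<close>

lemma coro_closed_disjoint_separate:
  assumes "a \<in> coro_closed X" "b \<in> coro_closed X" "a \<inter> b = {}"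
  obtains U V where "U \<in> CORO X" "V \<in> CORO X" "a \<subseteq> U" "b \<subseteq> V" "U \<inter> V = {}"
proof -
  define G where "G = {U \<in> CORO X. a \<subseteq> U \<or> b \<subseteq> U}"
  have "topspace X \<inter> \<Inter>G = {}"
  proof (rule ccontr)
    assume "topspace X \<inter> \<Inter>G \<noteq> {}"
    then obtain x where x: "x \<in> topspace X" "x \<in> \<Inter>G" by blast
    consider "x \<notin> a" | "x \<notin> b" using assms(3) by blast
    then show False
    proof cases
      case 1
      then show False using coro_closed_separate[OF assms(1) x(1)] x(2) unfolding G_def by blast
    next
      case 2
      then show False using coro_closed_separate[OF assms(2) x(1)] x(2) unfolding G_def by blast
    qed
  qed
  then obtain G0 where G0: "finite G0" "G0 \<subseteq> G" "topspace X \<inter> \<Inter>G0 = {}"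
    using CORO_compactness[of G] unfolding G_def by blast
  have fin: "topspace X \<inter> \<Inter>A \<in> CORO X" if "finite A" "A \<subseteq> CORO X" for A
    using that
  proof (induction A rule: finite_induct)
    case (insert U A)
    then have "U \<inter> (topspace X \<inter> \<Inter>A) \<in> CORO X" using CORO_Int by auto
    then show ?case by (simp add: Int_left_commute)
  qed (simp add: topspace_in_CORO)
  show ?thesis
  proof (rule that)
    let ?A = "{U \<in> G0. a \<subseteq> U}" and ?B = "{U \<in> G0. b \<subseteq> U}"
    show "topspace X \<inter> \<Inter>?A \<in> CORO X" "topspace X \<inter> \<Inter>?B \<in> CORO X"
      using G0 by (auto intro!: fin simp: G_def)
    show "a \<subseteq> topspace X \<inter> \<Inter>?A" "b \<subseteq> topspace X \<inter> \<Inter>?B"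
      using assms(1,2)[THEN coro_closed_subset] by auto
    show "(topspace X \<inter> \<Inter>?A) \<inter> (topspace X \<inter> \<Inter>?B) = {}"
      using G0 unfolding G_def by blast
  qed
qed

text \<open>
  Distributivity is proved pointwise: a point of every \<open>a \<sqinter> y\<close> outside some \<open>U\<close> above \<open>a\<close> and
  \<open>\<Inter>Y\<close> has a specialization \<open>w\<close> in the negation of \<open>U\<close>; from \<open>w\<close> one can move up into finitely
  many members of \<open>Y\<close> one after another, which contradicts compactness.
\<close>

lemma frame_coro_frame: "frame (coro_frame X)"
proof -
  interpret complete_lattice "coro_frame X" by (rule complete_lattice_coro_frame)
  show ?thesis
  proof unfold_locales
    fix a Y assume aY: "a \<in> carrier (coro_frame X)" "Y \<subseteq> carrier (coro_frame X)"
    \<comment> \<open>\<open>b\<close> is the join of \<open>Y\<close>, so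
      \<open>coro_hull X (a \<union> b)\<close> is the meet on the left of the frame law.\<close>
    define b where "b = topspace X \<inter> \<Inter>Y"
    have a: "a \<in> coro_closed X" and Y: "Y \<subseteq> coro_closed X" using aY by auto
    have b: "b \<in> coro_closed X" unfolding b_def using Y by (rule Inter_in_coro_closed)
    have "coro_hull X (a \<union> b) \<subseteq> coro_hull X (a \<union> y)" if "y \<in> Y" for y
      using that by (intro coro_hull_mono) (auto simp: b_def)
    moreover have "z \<in> coro_hull X (a \<union> b)"
      if z: "z \<in> topspace X" "\<And>y. y \<in> Y \<Longrightarrow> z \<in> coro_hull X (a \<union> y)" for z
    proof (rule coro_hullI[OF z(1)])
      fix U assume U: "U \<in> CORO X" "a \<union> b \<subseteq> U"
      show "z \<in> U"
      proof (rule ccontr)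
        assume "z \<notin> U"
        \<comment> \<open>\<open>U\<close> is its own double negation, so a point outside it has a
          point of \<open>neg U\<close> above it.\<close>
        then obtain w where w: "spec_le X z w" "w \<in> neg U"
          using CORO_neg_neg[OF U(1)] z(1) by (auto simp: int_le_def[of X "topspace X - neg U"])
        have wX: "w \<in> topspace X" using w by (simp add: spec_le_def)
        have wy: "w \<in> coro_hull X (a \<union> y)" if "y \<in> Y" for y
          using coro_closed_upset[OF coro_hull_closed z(2)[OF that] w(1)] .
        have meets: "\<exists>v. spec_le X w' v \<and> v \<in> y" if w': "spec_le X w w'" and y: "y \<in> Y" for w' y
        proof (rule ccontr)
          assume "\<nexists>v. spec_le X w' v \<and> v \<in> y"
          then have disj: "spec_up X w' \<inter> y = {}" by (auto simp: spec_up_def)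
          have w'X: "w' \<in> topspace X" using w' by (simp add: spec_le_def)
          obtain P Q where PQ: "P \<in> CORO X" "Q \<in> CORO X" "spec_up X w' \<subseteq> P" "y \<subseteq> Q" "P \<inter> Q = {}"
            using coro_closed_disjoint_separate[OF spec_up_coro_closed[OF w'X] _ disj] y Y by blast
          \<comment> \<open>\<open>?R\<close> will contain \<open>w'\<close>, yet it misses
            \<open>a\<close>, which lies in \<open>U\<close>, and \<open>y\<close>, which lies in
            \<open>Q\<close>. So \<open>neg ?R\<close> contains \<open>a \<union> y\<close>, hence
            \<open>w\<close>, hence \<open>w'\<close>.\<close>
          let ?R = "P \<inter> neg U"
          have R: "?R \<in> CORO X" using PQ U CORO_Int CORO_neg by blast
          have "U \<inter> ?R = {}" using CORO_disjoint_neg[of U X] by blast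
          then have "a \<subseteq> neg ?R" using CORO_subset_neg[OF U(1)] U(2) by blast
          moreover have "y \<subseteq> neg ?R" using CORO_subset_neg[OF PQ(2), of ?R] PQ(4,5) by blast
          ultimately have "w \<in> neg ?R"
            using coro_hullD[OF wy[OF y] CORO_neg[OF R]] by blast
          then have "w' \<in> neg ?R" using CORO_upset[OF CORO_neg[OF R]] w' by blast
          moreover have "w' \<in> ?R"
            using CORO_upset[OF CORO_neg[OF U(1)] w(2) w'] spec_up_subset_iff[OF w'X PQ(1)] PQ(3) by blast
          ultimately show False using CORO_disjoint_neg[of ?R X] by blast
        qed
        have fin: "\<exists>v. spec_le X w v \<and> v \<in> \<Inter>Y0" if "finite Y0" "Y0 \<subseteq> Y" for Y0
          using that
        proof (induction Y0 rule: finite_induct)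
          case empty
          then show ?case using spec_le_refl[OF wX] by blast
        next
          case (insert y Y0)
          then obtain v where v: "spec_le X w v" "v \<in> \<Inter>Y0" by auto
          obtain v' where v': "spec_le X v v'" "v' \<in> y" using meets[OF v(1)] insert by blast
          \<comment> \<open>Members of \<open>Y\<close> are upsets, so moving up into
            \<open>y\<close> does not leave the earlier ones.\<close>
          have "v' \<in> \<Inter>Y0"
          proof
            fix b assume "b \<in> Y0"
            then show "v' \<in> b"
              using coro_closed_upset[of b v v'] v v' insert.prems Y by blast
          qed
          then show ?case using v' spec_le_trans[OF v(1) v'(1)] by blast
        qed
        \<comment> \<open>Adding \<open>spec_up X w\<close> restricts attention to points above
          \<open>w\<close>; these stay in \<open>neg U\<close>, while \<open>b\<close> lies in
          \<open>U\<close>.\<close>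
        have "topspace X \<inter> \<Inter>(insert (spec_up X w) Y) = {}"
        proof (rule ccontr)
          assume "\<not> ?thesis"
          then obtain v where v: "v \<in> topspace X" "spec_le X w v" "v \<in> \<Inter>Y"
            by (auto simp: spec_up_def)
          then have "v \<in> U" using U b_def by blast
          moreover have "v \<in> neg U" using CORO_upset[OF CORO_neg[OF U(1)] w(2) v(2)] .
          ultimately show False using CORO_disjoint_neg[of U X] by blast
        qed
        then obtain Z where Z: "finite Z" "Z \<subseteq> insert (spec_up X w) Y" "topspace X \<inter> \<Inter>Z = {}"
          using coro_closed_compactness[of "insert (spec_up X w) Y"] Y spec_up_coro_closed[OF wX]
          by blast
        \<comment> \<open>\<open>Z\<close> may contain \<open>spec_up X w\<close>, which need not be
          in \<open>Y\<close>; it is dropped for \<open>fin\<close>, and \<open>v\<close> lies in it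
          anyway.\<close>
        obtain v where "spec_le X w v" "v \<in> \<Inter>(Z - {spec_up X w})"
          using fin[of "Z - {spec_up X w}"] Z by blast
        then have "v \<in> topspace X \<inter> \<Inter>Z" by (auto simp: spec_up_def spec_le_def)
        then show False using Z by blast
      qed
    qed
    ultimately have "coro_hull X (a \<union> b) = topspace X \<inter> (\<Inter>y\<in>Y. coro_hull X (a \<union> y))"
      using coro_closed_subset[OF coro_hull_closed, of X "a \<union> b"] by (intro equalityI subsetI) auto
    moreover have "{a \<sqinter>\<^bsub>coro_frame X\<^esub> y | y. y \<in> Y} = (\<lambda>y. coro_hull X (a \<union> y)) ` Y"
      using a Y meet_coro_frame[of a X] by (auto simp: image_iff subset_iff)
    moreover have "(\<lambda>y. coro_hull X (a \<union> y)) ` Y \<subseteq> coro_closed X"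
      using coro_hull_closed by blast
    ultimately show "a \<sqinter>\<^bsub>coro_frame X\<^esub> \<Squnion>\<^bsub>coro_frame X\<^esub>Y =
        \<Squnion>\<^bsub>coro_frame X\<^esub>{a \<sqinter>\<^bsub>coro_frame X\<^esub> y | y. y \<in> Y}"
      using a b Y by (simp add: sup_coro_frame meet_coro_frame flip: b_def)
  qed
qed

section \<open>Complementation and the remaining Stone axioms\<close>

lemma complemented_CORO:
  assumes "U \<in> CORO X"
  shows "complemented (coro_frame X) U"
proof -
  have N: "neg U \<in> CORO X" using assms by (rule CORO_neg)
  \<comment> \<open>If \<open>V\<close> in \<open>CORO X\<close> contains \<open>U\<close> and
    \<open>neg U\<close>, then \<open>neg V\<close> lies in the disjoint sets \<open>neg U\<close>
    and \<open>neg (neg U) = U\<close>. So \<open>V\<close> is the negation of the empty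
    set.\<close>
  have "coro_hull X (U \<union> neg U) = topspace X"
  proof -
    have "V = topspace X" if V: "V \<in> CORO X" "U \<union> neg U \<subseteq> V" for V
    proof -
      have "neg V \<subseteq> neg U" "neg V \<subseteq> neg (neg U)"
        using V(2) by (auto simp: int_le_def)
      then have "neg V = {}"
        using CORO_neg_neg[OF assms] CORO_disjoint_neg[of U X] by blast
      then have "V = neg {}" using CORO_neg_neg[OF V(1)] by simp
      then show ?thesis by (auto simp: int_le_def)
    qed
    then show ?thesis by (auto simp: coro_hull_def)
  qed
  then show ?thesis
    using assms N CORO_in_coro_closed[of _ X] CORO_disjoint_neg[of U X]
    by (auto simp: complemented_def meet_coro_frame join_coro_frame bottom_coro_frame top_coro_frame
        intro!: bexI[of _ "neg U"])
qed

lemma stone_locale_coro_frame: "stone_locale (coro_frame X)"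
proof -
  interpret frame "coro_frame X" by (rule frame_coro_frame)
  show ?thesis
  proof unfold_locales
    fix Y assume "Y \<subseteq> carrier (coro_frame X)" "\<Squnion>\<^bsub>coro_frame X\<^esub>Y = \<top>\<^bsub>coro_frame X\<^esub>"
    then have Y: "Y \<subseteq> coro_closed X" "topspace X \<inter> \<Inter>Y = {}"
      by (simp_all add: sup_coro_frame top_coro_frame)
    obtain Y0 where "finite Y0" "Y0 \<subseteq> Y" "topspace X \<inter> \<Inter>Y0 = {}"
      by (rule coro_closed_compactness[OF Y])
    then show "\<exists>Y0\<subseteq>Y. finite Y0 \<and> \<Squnion>\<^bsub>coro_frame X\<^esub>Y0 = \<top>\<^bsub>coro_frame X\<^esub>"
      using Y by (intro exI[of _ Y0]) (auto simp: sup_coro_frame[OF subset_trans[OF _ Y(1)]] top_coro_frame)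
  next
    fix a assume a: "a \<in> carrier (coro_frame X)"
    \<comment> \<open>Joins are intersections, so \<open>a\<close> is the join of its supersets in
      \<open>CORO X\<close>, which are complemented.\<close>
    let ?Y = "{U \<in> CORO X. a \<subseteq> U}"
    have "a = topspace X \<inter> \<Inter>?Y"
      using a coro_closed_separate[of a X] coro_closed_subset[of a X] unfolding coro_frame_sel by blast
    moreover have "?Y \<subseteq> coro_closed X" using CORO_in_coro_closed by blast
    ultimately show "\<exists>Y\<subseteq>{c. complemented (coro_frame X) c}. a = \<Squnion>\<^bsub>coro_frame X\<^esub>Y"
      using complemented_CORO by (intro exI[of _ ?Y]) (simp add: sup_coro_frame Collect_mono_iff)
  qed
qed

section \<open>The homeomorphism onto the upper Vietoris space\<close>

lemma bsquare_coro_frame: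
  assumes "a \<in> coro_closed X"
  shows "bsquare (coro_frame X) a = {b \<in> coro_closed X. b \<noteq> {} \<and> a \<inter> b = {}}"
  using assms by (auto simp: bsquare_def top_coro_frame join_coro_frame)

text \<open>Continuity on generators: separation encloses \<open>spec_up X x\<close> in an open
  \<open>V\<close> that misses \<open>a\<close>, and points of \<open>V\<close> have their upsets
  inside \<open>V\<close>.\<close>

lemma spec_up_vimage_bsquare:
  assumes a: "a \<in> coro_closed X"
  shows "openin X (spec_up X -` bsquare (coro_frame X) a \<inter> topspace X)"
proof (subst openin_subopen, intro ballI)
  fix x assume "x \<in> spec_up X -` bsquare (coro_frame X) a \<inter> topspace X"
  then have x: "x \<in> topspace X" "a \<inter> spec_up X x = {}"
    using bsquare_coro_frame[OF a] by auto
  obtain U V where UV: "U \<in> CORO X" "V \<in> CORO X" "a \<subseteq> U" "spec_up X x \<subseteq> V" "U \<inter> V = {}"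
    using coro_closed_disjoint_separate[OF a spec_up_coro_closed[OF x(1)] x(2)] .
  have "y \<in> spec_up X -` bsquare (coro_frame X) a \<inter> topspace X" if y: "y \<in> V" for y
  proof -
    have yX: "y \<in> topspace X" using CORO_subset UV(2) y by blast
    then have "spec_up X y \<subseteq> V" using spec_up_subset_iff UV(2) y by blast
    moreover have "y \<in> spec_up X y" using yX by (rule mem_spec_up)
    ultimately show ?thesis
      using yX UV bsquare_coro_frame[OF a] spec_up_coro_closed by auto
  qed
  moreover have "x \<in> V" using UV spec_up_subset_iff[OF x(1)] by blast
  moreover have "openin X V" using UV(2) by (simp add: CORO_def)
  ultimately show "\<exists>T. openin X T \<and> x \<in> T \<and> T \<subseteq> spec_up X -` bsquare (coro_frame X) a \<inter> topspace X"
    by blast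
qed

text \<open>This yields openness of \<open>spec_up X\<close>, as \<open>CORO X\<close> is a base. If
  the upset of \<open>x\<close> misses \<open>neg U\<close>, then \<open>x\<close> is in the double
  negation of \<open>U\<close>, which is \<open>U\<close>.\<close>

lemma spec_up_image_CORO:
  assumes U: "U \<in> CORO X"
  shows "spec_up X ` U = bsquare (coro_frame X) (neg U)"
proof (intro equalityI subsetI)
  note N = CORO_in_coro_closed[OF CORO_neg[OF U]]
  {
    fix b assume "b \<in> spec_up X ` U"
    then obtain x where x: "x \<in> U" "b = spec_up X x" by blast
    have xX: "x \<in> topspace X" using U x CORO_subset by blast
    have "b \<subseteq> U" using spec_up_subset_iff[OF xX U] x by blast
    moreover have "x \<in> b" using mem_spec_up[OF xX] x by simp
    ultimately show "b \<in> bsquare (coro_frame X) (neg U)"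
      using bsquare_coro_frame[OF N] spec_up_coro_closed[OF xX] x CORO_disjoint_neg[of U X] by blast
  next
    fix b assume "b \<in> bsquare (coro_frame X) (neg U)"
    then have b: "b \<in> coro_closed X" "b \<noteq> {}" "neg U \<inter> b = {}"
      using bsquare_coro_frame[OF N] by auto
    then obtain x where x: "x \<in> topspace X" "b = spec_up X x" using coro_closed_eq_spec_up by blast
    have "x \<in> neg (neg U)" using x b(3) by (auto simp: int_le_def[of X "topspace X - neg U"] spec_up_def)
    then show "b \<in> spec_up X ` U" using CORO_neg_neg[OF U] x by blast
  }
qed

lemma homeomorphic_map_spec_up: "homeomorphic_map X (upper_vietoris (coro_frame X)) (spec_up X)"
proof (rule bijective_open_imp_homeomorphic_map)
  have top: "topspace (upper_vietoris (coro_frame X)) = coro_closed X - {{}}"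
    using stone_locale.topspace_upper_vietoris[OF stone_locale_coro_frame] by (simp add: top_coro_frame)
  show im: "spec_up X ` topspace X = topspace (upper_vietoris (coro_frame X))"
    unfolding top
  proof (intro equalityI subsetI)
    fix a assume "a \<in> spec_up X ` topspace X"
    then obtain x where x: "x \<in> topspace X" "a = spec_up X x" by blast
    then show "a \<in> coro_closed X - {{}}"
      using spec_up_coro_closed[OF x(1)] mem_spec_up[OF x(1)] by blast
  next
    fix a assume "a \<in> coro_closed X - {{}}"
    then obtain x where "x \<in> topspace X" "a = spec_up X x" using coro_closed_eq_spec_up[of a] by blast
    then show "a \<in> spec_up X ` topspace X" by blast
  qed
  show "continuous_map X (upper_vietoris (coro_frame X)) (spec_up X)"
    unfolding upper_vietoris_def
  proof (rule continuous_on_generated_topo)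
    show "spec_up X ` topspace X \<subseteq> \<Union>{bsquare (coro_frame X) a |a. a \<in> carrier (coro_frame X)}"
      using im by (simp add: upper_vietoris_def topology_generated_by_topspace)
  qed (use spec_up_vimage_bsquare in auto)
  show "open_map X (upper_vietoris (coro_frame X)) (spec_up X)"
    unfolding open_map_def
  proof (intro allI impI)
    fix W assume W: "openin X W"
    show "openin (upper_vietoris (coro_frame X)) (spec_up X ` W)"
    proof (subst openin_subopen, intro ballI)
      fix b assume "b \<in> spec_up X ` W"
      then obtain x where x: "x \<in> W" "b = spec_up X x" by blast
      obtain U where U: "U \<in> CORO X" "x \<in> U" "U \<subseteq> W" by (rule CORO_base[OF W x(1)])
      have "openin (upper_vietoris (coro_frame X)) (spec_up X ` U)"
        unfolding spec_up_image_CORO[OF U(1)] upper_vietoris_def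
        using CORO_in_coro_closed[OF CORO_neg[OF U(1)]]
        by (intro topology_generated_by_Basis) auto
      then show "\<exists>T. openin (upper_vietoris (coro_frame X)) T \<and> b \<in> T \<and> T \<subseteq> spec_up X ` W"
        using U x by (intro exI[of _ "spec_up X ` U"]) auto
    qed
  qed
  show "inj_on (spec_up X) (topspace X)"
  proof (rule inj_onI)
    fix x y assume xy: "x \<in> topspace X" "y \<in> topspace X" "spec_up X x = spec_up X y"
    \<comment> \<open>Equal upsets put each point above the other, and T0 then identifies
      them.\<close>
    then have "spec_le X x y" "spec_le X y x" using mem_spec_up[of x X] mem_spec_up[of y X] by (auto simp: spec_up_def)
    then have "x \<in> U \<longleftrightarrow> y \<in> U" if "openin X U" for U
      using that by (auto simp: spec_le_def)
    moreover have "t0_space X" using uv by (simp add: UV_space_def)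
    ultimately show "x = y" using xy(1,2) unfolding t0_space_def by metis
  qed
qed

end

text \<open>An existential cannot range over types, so the locale is found at the fixed type
  \<open>'a set\<close>, where \<open>coro_frame X\<close> lives; the second conjunct gives the
  converse for locales over any type \<open>'b\<close>.\<close>

theorem theorem7p7:
  fixes X :: "'a topology"
  shows "(UV_space X \<longleftrightarrow>
            (\<exists>L :: 'a set gorder. stone_locale L \<and> X homeomorphic_space upper_vietoris L)) \<and>
         (\<forall>L :: 'b gorder. stone_locale L \<and> X homeomorphic_space upper_vietoris L \<longrightarrow> UV_space X)"
proof (intro conjI iffI allI impI)
  assume "UV_space X"
  then interpret uv_space X by unfold_locales
  show "\<exists>L :: 'a set gorder. stone_locale L \<and> X homeomorphic_space upper_vietoris L"
    using stone_locale_coro_frame homeomorphic_map_spec_up homeomorphic_space by blast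
qed (use UV_space_upper_vietoris in blast)+

end
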